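(* Let $K$ be the attractor of an infinite or finite iterated function system $\mathcal{F}$ on a compact metric space. If $K$ is a continuum and $\operatorname{s-dim}(\mathcal{F})=1$, then $K$ is isometric to a closed line segment, i.e. to an interval $[0,\ell]\subset\mathbb{R}$ for some $\ell\ge 0$.
   Context: A finite or infinite iterated function system on a compact metric space $X$ is a finite or countably infinite (nonempty) collection $\mathcal{F}=\{\phi_i : i\in A\}$ of contractions $\phi_i:X\to X$. Here $\operatorname{Lip}(\phi)$ is the infimum of all $L>0$ for which $\phi$ is $L$-Lipschitz, and it is always assumed that $\operatorname{Lip}(\phi_i)\in(0,1)$ for every $i\in A$. The attractor of $\mathcal{F}$ is $$K=\bigcup_{(i_n)\subset A}\ \bigcap_{n=1}^{\infty}\phi_{i_1}\circ\cdots\circ\phi_{i_n}(X),$$ where the union is over all infinite sequences $(i_n)_{n\ge 1}$ in $A$; when $\mathcal{F}$ is finite this is the unique nonempty compact set with $K=\bigcup_{\phi\in\mathcal{F}}\phi(K)$. The similarity dimension is $\operatorname{s-dim}(\mathcal{F})=\inf\{t\ge 0:\psi_{\mathcal{F}}(t)\le 1\}$, where $\psi_{\mathcal{F}}(t)=\sum_{i\in A}\operatorname{Lip}(\phi_i)^t$; for finite $\mathcal{F}$ it is the unique solution of $\psi_{\mathcal{F}}(t)=1$. A continuum is a nonempty compact connected set; a single point is allowed. *)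

theory Defs
  imports "HOL-Analysis.Analysis"
begin

text \<open>A compact metric space is given as a compact subset \<open>X\<close> of a type of class
  \<open>metric_space\<close>; self-maps of \<open>X\<close> are functions on the type whose values outside \<open>X\<close> never matter.\<close>

definition lip_const :: "'a::metric_space set \<Rightarrow> ('a \<Rightarrow> 'a) \<Rightarrow> real" where
  "lip_const X f = Inf {L. L > 0 \<and> L-lipschitz_on X f}"

text \<open>The existence of some Lipschitz constant below 1 is required separately: the real
  infimum in \<^const>\<open>lip_const\<close> carries no information for maps that are not Lipschitz.\<close>

definition contraction_on :: "'a::metric_space set \<Rightarrow> ('a \<Rightarrow> 'a) \<Rightarrow> bool" where
  "contraction_on X f \<longleftrightarrow> f \<in> X \<rightarrow> X \<and> (\<exists>L<1. L-lipschitz_on X f)"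

definition iterated_function_system ::
    "'a::metric_space set \<Rightarrow> 'i set \<Rightarrow> ('i \<Rightarrow> 'a \<Rightarrow> 'a) \<Rightarrow> bool" where
  "iterated_function_system X A \<phi> \<longleftrightarrow>
     countable A \<and> A \<noteq> {} \<and>
     (\<forall>i\<in>A. contraction_on X (\<phi> i) \<and> lip_const X (\<phi> i) \<in> {0<..<1})"

text \<open>Sequences are indexed from 0, so \<open>word_map \<phi> s n\<close> is
  \<open>\<phi> (s 0) \<circ> \<dots> \<circ> \<phi> (s (n - 1))\<close>.\<close>

fun word_map :: "('i \<Rightarrow> 'a \<Rightarrow> 'a) \<Rightarrow> (nat \<Rightarrow> 'i) \<Rightarrow> nat \<Rightarrow> 'a \<Rightarrow> 'a" where
  "word_map \<phi> s 0 = id"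
| "word_map \<phi> s (Suc n) = word_map \<phi> s n \<circ> \<phi> (s n)"

definition attractor :: "'a set \<Rightarrow> 'i set \<Rightarrow> ('i \<Rightarrow> 'a \<Rightarrow> 'a) \<Rightarrow> 'a set" where
  "attractor X A \<phi> = (\<Union>s\<in>UNIV \<rightarrow> A. \<Inter>n\<in>{1..}. word_map \<phi> s n ` X)"

text \<open>Both the sum and the infimum are taken in the extended nonnegative reals: a divergent
  sum is \<open>\<infinity>\<close>, and so is the dimension if the sum exceeds 1 for every exponent.\<close>

definition similarity_sum ::
    "'a::metric_space set \<Rightarrow> 'i set \<Rightarrow> ('i \<Rightarrow> 'a \<Rightarrow> 'a) \<Rightarrow> real \<Rightarrow> ennreal" where
  "similarity_sum X A \<phi> t = (\<Sum>\<^sub>\<infinity>i\<in>A. ennreal (lip_const X (\<phi> i) powr t))"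

definition similarity_dim ::
    "'a::metric_space set \<Rightarrow> 'i set \<Rightarrow> ('i \<Rightarrow> 'a \<Rightarrow> 'a) \<Rightarrow> ennreal" where
  "similarity_dim X A \<phi> = Inf (ennreal ` {t. t \<ge> 0 \<and> similarity_sum X A \<phi> t \<le> 1})"

definition continuum :: "'a::topological_space set \<Rightarrow> bool" where
  "continuum K \<longleftrightarrow> K \<noteq> {} \<and> compact K \<and> connected K"

definition isometric_sets :: "'a::metric_space set \<Rightarrow> 'b::metric_space set \<Rightarrow> bool" where
  "isometric_sets S T \<longleftrightarrow>
     (\<exists>f. bij_betw f S T \<and> (\<forall>x\<in>S. \<forall>y\<in>S. dist (f x) (f y) = dist x y))"

end

theory Submission
  imports Defs
begin

text \<open>
  Dimension 1 forces the Lipschitz constants to sum to at most 1, so the images of \<open>K\<close> under words of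
  length \<open>n\<close> are small covers of \<open>K\<close> with total diameter at most \<open>D = diameter K\<close>; thus \<open>K\<close> has
  one-dimensional Hausdorff measure at most \<open>D\<close>. Let \<open>f\<close> be the distance to an endpoint of a diameter,
  a 1-Lipschitz map of \<open>K\<close> onto \<open>{0..D}\<close>, which already accounts for the whole length. Consequently
  every small ball about a point \<open>x\<close> contains an entire level set of \<open>f\<close>. If \<open>x\<close> and \<open>y\<close> are almost
  cut off in this way at levels \<open>t < t'\<close>, then connectedness makes the distance to \<open>x\<close> take almost all
  values up to \<open>dist x y\<close> between the two levels, where only length \<open>t' - t\<close> is available. Hence
  \<open>dist x y \<le> \<bar>f x - f y\<bar>\<close> and \<open>f\<close> is an isometry.
\<close>

section \<open>Length-bounded covers and 1-Lipschitz images\<close>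

text \<open>Slightly stronger than one-dimensional Hausdorff measure at most \<open>l\<close>: the \<open>\<delta>\<close>-covers must meet the
  bound \<open>l\<close> itself, not \<open>l + \<epsilon>\<close>.\<close>

definition length_le :: "'a::metric_space set \<Rightarrow> real \<Rightarrow> bool" where
  "length_le K l \<longleftrightarrow>
     (\<forall>\<delta>>0. \<exists>S::nat \<Rightarrow> 'a set. K \<subseteq> (\<Union>n. S n) \<and> (\<forall>n. bounded (S n) \<and> diameter (S n) < \<delta>) \<and>
        (\<forall>N. finite N \<longrightarrow> (\<Sum>n\<in>N. diameter (S n)) \<le> l))"

lemma lipschitz_image_in_interval:
  fixes g :: "'a::metric_space \<Rightarrow> real"
  assumes g: "1-lipschitz_on UNIV g" and S: "bounded S"
  obtains c where "g ` S \<subseteq> {c..c + diameter S}"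
proof (cases "S = {}")
  case False
  have d: "g u - g v \<le> diameter S" if "u \<in> S" "v \<in> S" for u v
    using lipschitz_onD[OF g, of u v] diameter_bounded_bound[OF S that] by (simp add: dist_real_def)
  have bdd: "bdd_below (g ` S)"
  proof -
    from False obtain u where "u \<in> S" by blast
    then show ?thesis
      by (intro bdd_belowI2[of _ "g u - diameter S"]) (use d in force)
  qed
  have "g u \<le> Inf (g ` S) + diameter S" if "u \<in> S" for u
  proof -
    have "g u - diameter S \<le> Inf (g ` S)"
      using False d[OF that] by (intro cINF_greatest) (auto simp: algebra_simps)
    then show ?thesis by simp
  qed
  then show ?thesis
    using bdd by (intro that[of "Inf (g ` S)"]) (auto intro: cINF_lower)
qed simp

text \<open>Only members of the cover that meet \<open>E\<close> are charged. This lets two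
  separated sets share one cover in \<open>length_le_separated\<close>.\<close>

lemma emeasure_lipschitz_image_le:
  fixes g :: "'a::metric_space \<Rightarrow> real"
  assumes g: "1-lipschitz_on UNIV g"
    and cover: "E \<subseteq> (\<Union>n. S n)" and bdd: "\<And>n::nat. bounded (S n)"
  shows "emeasure lborel (g ` E) \<le> (\<Sum>n. ennreal (if S n \<inter> E = {} then 0 else diameter (S n)))"
proof -
  have "\<exists>c. g ` S n \<subseteq> {c..c + diameter (S n)}" for n
    using lipschitz_image_in_interval[OF g bdd] by metis
  then obtain c where c: "\<And>n. g ` S n \<subseteq> {c n..c n + diameter (S n)}" by metis
  define B where "B n = (if S n \<inter> E = {} then {} else {c n..c n + diameter (S n)})" for n
  have "g ` E \<subseteq> (\<Union>n. B n)"
  proof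
    fix y assume "y \<in> g ` E"
    then obtain x n where "x \<in> E" "y = g x" "x \<in> S n" using cover by blast
    then have "y \<in> B n" using c[of n] by (auto simp: B_def)
    then show "y \<in> (\<Union>n. B n)" by blast
  qed
  then have "emeasure lborel (g ` E) \<le> emeasure lborel (\<Union>n. B n)"
    by (intro emeasure_mono) (auto simp: B_def)
  also have "\<dots> \<le> (\<Sum>n. emeasure lborel (B n))"
    by (intro emeasure_subadditive_countably) (auto simp: B_def)
  also have "\<dots> = (\<Sum>n. ennreal (if S n \<inter> E = {} then 0 else diameter (S n)))"
    by (intro suminf_cong) (simp add: B_def bdd diameter_ge_0)
  finally show ?thesis .
qed

text \<open>In a cover of mesh below \<open>\<eta>\<close> no member meets both \<open>E\<close> and
  \<open>F\<close>, so each diameter is charged to at most one of them. Two different functions are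
  allowed because \<open>f\<close> will measure one piece and the distance to a point the
  other.\<close>

lemma length_le_separated:
  fixes g h :: "'a::metric_space \<Rightarrow> real"
  assumes K: "length_le K l"
    and g: "1-lipschitz_on UNIV g" and h: "1-lipschitz_on UNIV h"
    and sub: "E \<subseteq> K" "F \<subseteq> K" and \<eta>: "\<eta> > 0"
    and sep: "\<And>x y. x \<in> E \<Longrightarrow> y \<in> F \<Longrightarrow> dist x y \<ge> \<eta>"
    and comp: "compact E" "compact F"
  shows "measure lborel (g ` E) + measure lborel (h ` F) \<le> l"
proof -
  obtain S :: "nat \<Rightarrow> 'a set" where cover: "K \<subseteq> (\<Union>n. S n)"
    and bdd: "\<And>n. bounded (S n)" and small: "\<And>n. diameter (S n) < \<eta>"
    and sums: "\<And>N. finite N \<Longrightarrow> (\<Sum>n\<in>N. diameter (S n)) \<le> l"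
    using K \<eta> unfolding length_le_def by meson
  define d where "d T n = (if S n \<inter> T = {} then 0 else diameter (S n))" for T n
  have nonneg: "0 \<le> d T n" for T n by (simp add: d_def diameter_ge_0 bdd)
  have meets_one: "d E n + d F n \<le> diameter (S n)" for n
  proof (cases "S n \<inter> E = {} \<or> S n \<inter> F = {}")
    case True
    then show ?thesis by (auto simp: d_def diameter_ge_0 bdd)
  next
    case False
    then obtain x y where "x \<in> S n" "x \<in> E" "y \<in> S n" "y \<in> F" by blast
    then show ?thesis
      using sep[of x y] diameter_bounded_bound[OF bdd, of x n y] small[of n] by simp
  qed
  have "ennreal (measure lborel (g ` E) + measure lborel (h ` F))
      = emeasure lborel (g ` E) + emeasure lborel (h ` F)"
  \<comment> \<open>Compactness makes both measures finite, so the real-valued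
    \<open>measure\<close> agrees with \<open>emeasure\<close>.\<close>
  proof -
    have "continuous_on T g" "continuous_on T h" for T
      using g h lipschitz_on_continuous_on lipschitz_on_subset by blast+
    then have "compact (g ` E)" "compact (h ` F)"
      using comp compact_continuous_image by blast+
    then have "emeasure lborel (g ` E) \<noteq> top" "emeasure lborel (h ` F) \<noteq> top"
      using emeasure_compact_finite by fastforce+
    then show ?thesis
      by (simp add: emeasure_eq_ennreal_measure ennreal_plus)
  qed
  also have "\<dots> \<le> (\<Sum>n. ennreal (d E n)) + (\<Sum>n. ennreal (d F n))"
    unfolding d_def using sub cover
    by (intro add_mono emeasure_lipschitz_image_le g h bdd) auto
  also have "\<dots> = (\<Sum>n. ennreal (d E n + d F n))"
    by (simp add: suminf_add nonneg ennreal_plus)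
  also have "\<dots> \<le> ennreal l"
  proof (rule suminf_le_const)
    show "(\<Sum>n<N. ennreal (d E n + d F n)) \<le> ennreal l" for N
    proof -
      have "(\<Sum>n<N. d E n + d F n) \<le> l"
        using sum_mono[of "{..<N}" "\<lambda>n. d E n + d F n" "\<lambda>n. diameter (S n)"] meets_one sums[of "{..<N}"]
        by fastforce
      then show ?thesis
        by (simp add: sum_ennreal nonneg ennreal_leI del: ennreal_plus)
    qed
  qed simp
  finally show ?thesis
    \<comment> \<open>The empty sum gives \<open>0 \<le> l\<close>, which is needed to return from
      \<open>ennreal\<close> to the reals.\<close>
    using sums[of "{}"] by (simp flip: ennreal_plus)
qed

section \<open>Level sets of a 1-Lipschitz function on a continuum\<close>

lemma lipschitz_on_dist: "1-lipschitz_on UNIV (dist (a::'a::metric_space))"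
proof (rule lipschitz_onI)
  show "dist (dist a x) (dist a y) \<le> 1 * dist x y" for x y
    using dist_triangle[of a x y] dist_triangle[of a y x] by (simp add: dist_real_def dist_commute)
qed simp

lemma measure_ge_interval:
  fixes T :: "real set"
  assumes "{c..d} \<subseteq> T" "compact T"
  shows "d - c \<le> measure lborel T"
proof -
  have "measure lborel {c..d} \<le> measure lborel T"
    using assms emeasure_compact_finite[OF assms(2)]
    by (intro measure_mono_fmeasurable) (auto simp: fmeasurable_def borel_compact)
  then show ?thesis by (cases "c \<le> d") (auto intro: order_trans[OF _ measure_nonneg])
qed

text \<open>Otherwise \<open>f\<close> already uses up the whole length \<open>D\<close> outside the ball, while a smaller
  concentric ball contains a connected piece of positive length.\<close>

lemma ex_level_set_in_ball:
  fixes f :: "'a::metric_space \<Rightarrow> real"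
  assumes K: "compact K" "connected K" "length_le K D"
    and f: "1-lipschitz_on UNIV f" "f ` K = {0..D}"
    and x: "x \<in> K" and r: "r > 0" and z: "z \<in> K" "r \<le> dist x z"
  obtains t where "t \<in> {0..D}" "K \<inter> f -` {t} \<subseteq> ball x r"
proof (rule ccontr)
  assume neg: "\<not> thesis"
  \<comment> \<open>The radii \<open>r\<close> and \<open>r/2\<close> leave a gap of
    \<open>r/2\<close> between the two sets. The total length would then be at least
    \<open>D + r/2\<close>.\<close>
  define E F where "E = K - ball x r" and "F = K \<inter> cball x (r/2)"
  have comp: "compact E" "compact F"
    using K by (auto simp: E_def F_def compact_diff compact_Int_closed)
  have cont: "continuous_on T f" for T
    by (rule lipschitz_on_continuous_on[OF lipschitz_on_subset[OF f(1)]]) simp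
  have "{0..D} \<subseteq> f ` E"
  proof
    fix t assume t: "t \<in> {0..D}"
    then have "\<not> K \<inter> f -` {t} \<subseteq> ball x r" using neg that by blast
    then show "t \<in> f ` E" by (auto simp: E_def)
  qed
  then have 1: "D - 0 \<le> measure lborel (f ` E)"
    by (rule measure_ge_interval) (intro compact_continuous_image cont comp)
  \<comment> \<open>The far point \<open>z\<close> and connectedness force the distance to
    \<open>x\<close> through all small values.\<close>
  have "{0..r/2} \<subseteq> dist x ` F"
  proof
    fix s assume s: "s \<in> {0..r/2}"
    have "connected (dist x ` K)"
      by (intro connected_continuous_image continuous_intros K)
    moreover have "dist x x \<in> dist x ` K" "dist x z \<in> dist x ` K"
      by (rule imageI, fact x) (rule imageI, fact z(1))
    moreover have "dist x x \<le> s" "s \<le> dist x z" using s z(2) r by auto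
    ultimately have "s \<in> dist x ` K" by (rule connectedD_interval)
    then show "s \<in> dist x ` F" using s by (auto simp: F_def)
  qed
  then have 2: "r/2 - 0 \<le> measure lborel (dist x ` F)"
    by (rule measure_ge_interval) (intro compact_continuous_image continuous_intros comp)
  have sep: "r/2 \<le> dist u v" if "u \<in> E" "v \<in> F" for u v
    using that dist_triangle[of x u v] by (auto simp: E_def F_def dist_commute)
  have "E \<subseteq> K" "F \<subseteq> K" by (auto simp: E_def F_def)
  from length_le_separated[OF K(3) f(1) lipschitz_on_dist this half_gt_zero[OF r] sep comp]
  have "measure lborel (f ` E) + measure lborel (dist x ` F) \<le> D" .
  with 1 2 r show False by simp
qed

text \<open>Outside the slab between the two levels \<open>f\<close> uses length at least
  \<open>D - (t' - t + 2 * r)\<close>. Inside it the distance to \<open>x\<close> uses at least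
  \<open>dist x y - 2 * r\<close>. Both must fit into \<open>D\<close>.\<close>

lemma dist_le_level_diff:
  fixes f :: "'a::metric_space \<Rightarrow> real"
  assumes K: "compact K" "connected K" "length_le K D"
    and f: "1-lipschitz_on UNIV f" "f ` K = {0..D}"
    and t: "t \<in> {0..D}" "K \<inter> f -` {t} \<subseteq> ball x r"
    and t': "t' \<in> {0..D}" "K \<inter> f -` {t'} \<subseteq> ball y r"
    and less: "t < t'" and r: "r > 0"
  shows "dist x y \<le> t' - t + 4 * r"
proof -
  \<comment> \<open>Margins of width \<open>r\<close> on both sides of the slab \<open>M\<close>
    keep \<open>E\<close> at distance at least \<open>r\<close> from it, since \<open>f\<close> is
    1-Lipschitz.\<close>
  define E M where "E = K \<inter> (f -` {..t - r} \<union> f -` {t' + r..})" and "M = K \<inter> f -` {t..t'}"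
  have cont: "continuous_on T f" for T
    by (rule lipschitz_on_continuous_on[OF lipschitz_on_subset[OF f(1)]]) simp
  have cl: "closed (f -` T)" if "closed T" for T
    using continuous_closed_vimage[OF that, of f] cont[of UNIV] by (simp add: continuous_on_eq_continuous_at)
  have op: "open (f -` T)" if "open T" for T
    using continuous_open_vimage[OF that, of f] cont[of UNIV] by (simp add: continuous_on_eq_continuous_at)
  have comp: "compact E" "compact M"
    unfolding E_def M_def by (intro compact_Int_closed K closed_Un cl; simp)+
  have compf: "compact (f ` E)"
    by (intro compact_continuous_image cont comp)
  have compM: "compact (dist x ` M)"
    by (intro compact_continuous_image continuous_intros comp)
  have 1: "D \<le> measure lborel (f ` E) + (t' - t + 2 * r)"
  proof -
    have "{0..D} \<subseteq> f ` E \<union> {t - r..t' + r}"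
    proof
      fix s assume "s \<in> {0..D}"
      then obtain u where "u \<in> K" "s = f u" using f by (metis imageE)
      then show "s \<in> f ` E \<union> {t - r..t' + r}" by (auto simp: E_def)
    qed
    then have "D - 0 \<le> measure lborel (f ` E \<union> {t - r..t' + r})"
      by (rule measure_ge_interval) (intro compact_Un compf compact_Icc)
    also have "\<dots> \<le> measure lborel (f ` E) + measure lborel {t - r..t' + r}"
      using compf by (intro measure_Un_le) (auto intro: borel_compact)
    also have "measure lborel {t - r..t' + r} = t' - t + 2 * r"
      using less r by simp
    finally show ?thesis by simp
  qed
  have "{r..dist x y - r} \<subseteq> dist x ` M"
  proof
    fix c assume c: "c \<in> {r..dist x y - r}"
    show "c \<in> dist x ` M"
    proof (rule ccontr)
      assume no: "c \<notin> dist x ` M"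
      have at_t: "dist x z < c" if "z \<in> K" "f z = t" for z
        using that t(2) c by force
      have at_t': "dist x z > c" if "z \<in> K" "f z = t'" for z
      proof -
        have "dist y z < r" using that t'(2) by force
        then show ?thesis using c dist_triangle2[of x y z] by auto
      qed
      \<comment> \<open>If the value \<open>c\<close> is skipped in the slab, the sphere of radius
        \<open>c\<close> about \<open>x\<close> cuts \<open>K\<close> there. \<open>U\<close> is the
        part on the side of level \<open>t\<close>, all of which is nearer to \<open>x\<close> than
        \<open>c\<close>; \<open>V\<close> is the part on the side of level \<open>t'\<close>, all
        of which is farther.\<close>
      define U V where
        "U = f -` {..<t} \<union> f -` {..<t'} \<inter> ball x c" and
        "V = f -` {t'<..} \<union> f -` {t<..} \<inter> - cball x c"
      have "open U" "open V"
        unfolding U_def V_def by (auto intro!: open_Un open_Int op)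
      moreover have "K \<subseteq> U \<union> V"
      proof
        fix z assume z: "z \<in> K"
        consider "f z < t" | "f z > t'" | "f z = t" | "f z = t'" | "t < f z" "f z < t'" by linarith
        then show "z \<in> U \<union> V"
        proof cases
          case 3
          then show ?thesis using at_t[OF z] less by (simp add: U_def)
        next
          case 4
          then show ?thesis using at_t'[OF z] less by (simp add: V_def)
        next
          case 5
          then have "z \<in> M" using z by (simp add: M_def)
          then have "dist x z \<noteq> c" using no by blast
          with 5 show ?thesis by (auto simp: U_def V_def)
        qed (simp_all add: U_def V_def)
      qed
      moreover have "U \<inter> V \<inter> K = {}"
        using less by (auto simp: U_def V_def)
      moreover have "U \<inter> K \<noteq> {}" "V \<inter> K \<noteq> {}"
      proof -
        obtain u v where "u \<in> K" "f u = t" "v \<in> K" "f v = t'"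
          using t(1) t'(1) f(2) by (metis imageE)
        then have "u \<in> U \<inter> K" "v \<in> V \<inter> K"
          using at_t[of u] at_t'[of v] less by (simp_all add: U_def V_def)
        then show "U \<inter> K \<noteq> {}" "V \<inter> K \<noteq> {}" by blast+
      qed
      ultimately show False
        using K(2) unfolding connected_def by blast
    qed
  qed
  then have 2: "dist x y - r - r \<le> measure lborel (dist x ` M)"
    using compM by (rule measure_ge_interval)
  have sep: "r \<le> dist u v" if "u \<in> E" "v \<in> M" for u v
    using that lipschitz_onD[OF f(1), of u v] by (auto simp: E_def M_def dist_real_def)
  have "E \<subseteq> K" "M \<subseteq> K" by (auto simp: E_def M_def)
  from length_le_separated[OF K(3) f(1) lipschitz_on_dist this r sep comp]
  have "measure lborel (f ` E) + measure lborel (dist x ` M) \<le> D" .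
  with 1 2 show ?thesis by simp
qed

theorem isometric_interval_of_length_le_diameter:
  fixes K :: "'a::metric_space set"
  assumes K: "continuum K" "length_le K (diameter K)"
  shows "isometric_sets K {0..diameter K}"
proof -
  define D where "D = diameter K"
  have comp: "compact K" and conn: "connected K" and ne: "K \<noteq> {}"
    using K by (auto simp: continuum_def)
  have bdd: "bounded K" by (simp add: comp compact_imp_bounded)
  obtain a b where ab: "a \<in> K" "b \<in> K" "dist a b = D"
    using diameter_compact_attained[OF comp ne] unfolding D_def by blast
  define f where "f = dist a"
  have f: "1-lipschitz_on UNIV f" unfolding f_def by (rule lipschitz_on_dist)
  have img: "f ` K = {0..D}"
  proof
    show "f ` K \<subseteq> {0..D}"
      using diameter_bounded_bound[OF bdd ab(1)] by (auto simp: f_def D_def)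
    have "connected (f ` K)" unfolding f_def
      by (intro connected_continuous_image continuous_intros conn)
    then show "{0..D} \<subseteq> f ` K"
      by (rule connected_contains_Icc) (use ab in \<open>auto simp: f_def image_iff\<close>)
  qed
  have len: "length_le K D" using K by (simp add: D_def)
  \<comment> \<open>Of the \<open>6 * r\<close>, four come from \<open>dist_le_level_diff\<close>
    and two from replacing \<open>f x\<close> and \<open>f y\<close> by the levels \<open>t\<close>
    and \<open>t'\<close>. The bound on \<open>r\<close> ensures that \<open>a\<close> or
    \<open>b\<close> is at distance at least \<open>r\<close> from any given point.\<close>
  have main: "dist x y \<le> \<bar>f x - f y\<bar> + 6 * r"
    if x: "x \<in> K" and y: "y \<in> K" and r: "0 < r" "2 * r \<le> D" for x y r
  proof -
    have far: "\<exists>z\<in>K. r \<le> dist w z" for w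
    proof -
      have "r \<le> dist w a \<or> r \<le> dist w b"
        using dist_triangle3[of a b w] ab(3) r by linarith
      then show ?thesis using ab by blast
    qed
    have level: "\<exists>t\<in>{0..D}. K \<inter> f -` {t} \<subseteq> ball w r" if w: "w \<in> K" for w
      using far[of w] ex_level_set_in_ball[OF comp conn len f img w r(1)] by metis
    have close: "\<bar>f w - t\<bar> < r \<and> (\<exists>z\<in>K. f z = t \<and> dist w z < r)"
      if t: "t \<in> {0..D}" "K \<inter> f -` {t} \<subseteq> ball w r" for w t
    proof -
      obtain z where z: "z \<in> K" "f z = t" using t(1) img by (metis imageE)
      then have "dist w z < r" using t(2) by auto
      then show ?thesis using z lipschitz_onD[OF f, of w z] by (auto simp: dist_real_def)
    qed
    obtain t where t: "t \<in> {0..D}" "K \<inter> f -` {t} \<subseteq> ball x r" using level[OF x] by blast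
    obtain t' where t': "t' \<in> {0..D}" "K \<inter> f -` {t'} \<subseteq> ball y r" using level[OF y] by blast
    have "dist x y \<le> \<bar>t' - t\<bar> + 4 * r"
    proof (cases t t' rule: linorder_cases)
      case less
      then show ?thesis using dist_le_level_diff[OF comp conn len f img t t' less r(1)] by simp
    next
      case greater
      then show ?thesis
        using dist_le_level_diff[OF comp conn len f img t' t greater r(1)] by (simp add: dist_commute)
    next
      \<comment> \<open>A point on the common level lies within \<open>r\<close> of both
        \<open>x\<close> and \<open>y\<close>.\<close>
      case equal
      obtain z where "z \<in> K" "f z = t" "dist x z < r" using close[OF t] by blast
      moreover then have "dist y z < r" using t'(2) equal by auto
      ultimately show ?thesis using dist_triangle2[of x y z] r by simp
    qed
    then show ?thesis using close[OF t] close[OF t'] by linarith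
  qed
  have iso: "dist (f x) (f y) = dist x y" if x: "x \<in> K" and y: "y \<in> K" for x y
  proof (rule antisym)
    show "dist (f x) (f y) \<le> dist x y" using lipschitz_onD[OF f, of x y] by simp
    show "dist x y \<le> dist (f x) (f y)"
    \<comment> \<open>If \<open>D = 0\<close>, no positive \<open>r\<close> is admissible in
      \<open>main\<close>, but then \<open>K\<close> is a single point.\<close>
    proof (cases "D > 0")
      case True
      show ?thesis
      proof (rule field_le_epsilon)
        fix e :: real assume "e > 0"
        then have "dist x y \<le> \<bar>f x - f y\<bar> + 6 * min (e/6) (D/2)"
          using True by (intro main x y) auto
        then show "dist x y \<le> dist (f x) (f y) + e" by (simp add: dist_real_def)
      qed
    next
      case False
      then have "dist x y \<le> 0"
        using diameter_bounded_bound[OF bdd x y] unfolding D_def by linarith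
      then show ?thesis by (rule order_trans) simp
    qed
  qed
  have "inj_on f K"
  proof (rule inj_onI)
    fix x y assume "x \<in> K" "y \<in> K" "f x = f y"
    then show "x = y" using iso[of x y] by simp
  qed
  then have "bij_betw f K {0..D}" using img by (simp add: bij_betw_def)
  then show ?thesis
    using iso unfolding isometric_sets_def D_def[symmetric] by (intro exI[of _ f] conjI ballI)
qed

section \<open>Lipschitz constants and the similarity dimension\<close>

text \<open>Each quotient of distances is a lower bound for the admissible constants, hence at most
  their infimum.\<close>

lemma lipschitz_on_lip_const:
  assumes "contraction_on X f"
  shows "(lip_const X f)-lipschitz_on X f"
proof -
  define Ls where "Ls = {L. L > 0 \<and> L-lipschitz_on X f}"
  obtain L where L: "L-lipschitz_on X f" using assms by (auto simp: contraction_on_def)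
  have ne: "Ls \<noteq> {}"
    using lipschitz_on_le[OF L, of "max L 1"] by (auto simp: Ls_def intro!: exI[of _ "max L 1"])
  have lip: "lip_const X f = Inf Ls" by (simp add: lip_const_def Ls_def)
  show ?thesis
  proof (rule lipschitz_onI)
    show "0 \<le> lip_const X f" unfolding lip
      by (rule cInf_greatest[OF ne]) (auto simp: Ls_def)
    fix x y assume xy: "x \<in> X" "y \<in> X"
    show "dist (f x) (f y) \<le> lip_const X f * dist x y"
    proof (cases "dist x y = 0")
      case False
      then have pos: "dist x y > 0" by simp
      have "dist (f x) (f y) / dist x y \<le> Inf Ls"
        by (rule cInf_greatest[OF ne])
          (use xy pos in \<open>auto simp: Ls_def pos_divide_le_eq dest: lipschitz_onD\<close>)
      with pos show ?thesis by (simp add: lip pos_divide_le_eq)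
    qed simp
  qed
qed

lemma diameter_lipschitz_image_le:
  assumes "L-lipschitz_on S f" "bounded S"
  shows "diameter (f ` S) \<le> L * diameter S"
proof (cases "S = {}")
  case False
  have "dist u v \<le> L * diameter S" if uv: "u \<in> f ` S" "v \<in> f ` S" for u v
  proof -
    obtain x y where "x \<in> S" "y \<in> S" "u = f x" "v = f y" using uv by blast
    then show ?thesis
      using lipschitz_onD[OF assms(1)] diameter_bounded_bound[OF assms(2)] lipschitz_on_nonneg[OF assms(1)]
      by (meson mult_left_mono order_trans)
  qed
  with False show ?thesis
    by (auto simp: diameter_def intro!: cSUP_least)
qed simp

text \<open>A finite partial sum above 1 at exponent 1 stays above 1 at some \<open>t > 1\<close> by
  continuity. It decreases in the exponent, so every admissible exponent is at least
  \<open>t\<close> and the dimension exceeds 1. Finite sums avoid any question of continuity of the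
  full series.\<close>

lemma sum_lip_const_le_1:
  assumes lip: "\<And>i. i \<in> A \<Longrightarrow> lip_const X (\<phi> i) \<in> {0<..<1}"
    and dim: "similarity_dim X A \<phi> = 1"
    and F: "finite F" "F \<subseteq> A"
  shows "(\<Sum>i\<in>F. lip_const X (\<phi> i)) \<le> 1"
proof (rule ccontr)
  assume gt: "\<not> ?thesis"
  define p where "p t = (\<Sum>i\<in>F. lip_const X (\<phi> i) powr t)" for t
  have "1 < p 1" using gt lip F by (simp add: p_def subset_iff less_imp_le)
  moreover have "isCont p 1" unfolding p_def
    using lip F by (intro continuous_intros) (auto simp: subset_iff)
  then have "(p \<longlongrightarrow> p 1) (at_right 1)"
    by (simp add: isCont_def filterlim_at_split)
  ultimately have "\<forall>\<^sub>F t in at_right 1. 1 < p t"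
    by (simp add: order_tendstoD)
  then obtain t where t: "1 < t" "1 < p t"
    unfolding eventually_at_right_field by (metis dense)
  have "ennreal t \<le> ennreal u" if u: "similarity_sum X A \<phi> u \<le> 1" for u
  proof (rule ccontr)
    assume "\<not> ennreal t \<le> ennreal u"
    then have ut: "u \<le> t" by (meson ennreal_leI linear)
    have "p t \<le> p u" unfolding p_def
      using lip F ut by (intro sum_mono powr_mono') (auto simp: subset_iff less_imp_le)
    then have "1 < ennreal (p u)" using t by (simp add: ennreal_less_iff flip: ennreal_1)
    also have "ennreal (p u) = (\<Sum>i\<in>F. ennreal (lip_const X (\<phi> i) powr u))"
      by (simp add: p_def sum_ennreal)
    also have "\<dots> = (\<Sum>\<^sub>\<infinity>i\<in>F. ennreal (lip_const X (\<phi> i) powr u))"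
      by (simp add: F)
    also have "\<dots> \<le> similarity_sum X A \<phi> u" unfolding similarity_sum_def
      using F by (intro infsum_mono_neutral nonneg_summable_on_complete) auto
    finally show False using u by simp
  qed
  then have "ennreal t \<le> similarity_dim X A \<phi>"
    unfolding similarity_dim_def by (intro Inf_greatest) auto
  then show False using dim t by (simp flip: ennreal_1)
qed

section \<open>Self-covering of the attractor\<close>

text \<open>The recursion splits off the innermost map; the attractor argument needs the outermost
  one.\<close>

lemma word_map_Suc_shift: "word_map \<phi> s (Suc n) = \<phi> (s 0) \<circ> word_map \<phi> (\<lambda>k. s (Suc k)) n"
  by (induction n) (simp_all add: fun_eq_iff)

lemma word_map_continuous:
  assumes "s \<in> UNIV \<rightarrow> A" "\<And>i. i \<in> A \<Longrightarrow> \<phi> i \<in> X \<rightarrow> X" "\<And>i. i \<in> A \<Longrightarrow> continuous_on X (\<phi> i)"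
  shows "continuous_on X (word_map \<phi> s n) \<and> word_map \<phi> s n \<in> X \<rightarrow> X"
proof (induction n)
  case (Suc n)
  have i: "s n \<in> A" using assms(1) by auto
  have "continuous_on X (word_map \<phi> s n \<circ> \<phi> (s n))"
    using Suc assms(2)[OF i] assms(3)[OF i]
    by (intro continuous_on_compose) (auto intro: continuous_on_subset)
  then show ?case using Suc assms(2)[OF i] by auto
qed (auto simp: id_def)

text \<open>As \<open>\<phi> (s 0)\<close> need not be injective, the preimages of \<open>x\<close>
  may vary with \<open>n\<close>. Those in the images along the shifted sequence form nested
  nonempty compact sets, so one of them works for all \<open>n\<close>.\<close>

lemma attractor_subset_images:
  fixes X :: "'a::metric_space set"
  assumes X: "compact X"
    and maps: "\<And>i. i \<in> A \<Longrightarrow> \<phi> i \<in> X \<rightarrow> X" and cont: "\<And>i. i \<in> A \<Longrightarrow> continuous_on X (\<phi> i)"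
  shows "attractor X A \<phi> \<subseteq> (\<Union>i\<in>A. \<phi> i ` attractor X A \<phi>)"
proof
  fix x assume "x \<in> attractor X A \<phi>"
  then obtain s where s: "s \<in> UNIV \<rightarrow> A" and x: "\<And>n. n \<ge> 1 \<Longrightarrow> x \<in> word_map \<phi> s n ` X"
    unfolding attractor_def by auto
  define s' where "s' k = s (Suc k)" for k
  have s': "s' \<in> UNIV \<rightarrow> A" and s0: "s 0 \<in> A" using s by (auto simp: s'_def)
  have wm: "continuous_on X (word_map \<phi> s' n) \<and> word_map \<phi> s' n \<in> X \<rightarrow> X" for n
    using word_map_continuous[of s' A \<phi> X n] s' maps cont by blast
  define P where "P n = {y \<in> word_map \<phi> s' n ` X. \<phi> (s 0) y = x}" for n
  have sub: "word_map \<phi> s' n ` X \<subseteq> X" for n using wm[of n] by auto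
  have "(\<Inter>n. P n) \<noteq> {}"
  proof (rule compact_space_imp_nest)
    show "compact_space (top_of_set X)" using X by (simp add: compact_space_subtopology)
    show "closedin (top_of_set X) (P n)" for n
    proof -
      have img: "compact (word_map \<phi> s' n ` X)"
        using wm X compact_continuous_image by blast
      have "closedin (top_of_set (word_map \<phi> s' n ` X)) (P n)"
        unfolding P_def
        by (rule continuous_closedin_preimage_constant[OF continuous_on_subset[OF cont[OF s0] sub]])
      then have "compact (P n)" using img closedin_compact by blast
      then show ?thesis using X sub by (auto simp: closedin_compact_eq P_def)
    qed
    show "P n \<noteq> {}" for n
    proof -
      have "x \<in> (\<phi> (s 0) \<circ> word_map \<phi> s' n) ` X"
        using x[of "Suc n"] unfolding word_map_Suc_shift s'_def[abs_def] by simp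
      then obtain z where "z \<in> X" "x = \<phi> (s 0) (word_map \<phi> s' n z)" by auto
      then have "word_map \<phi> s' n z \<in> P n" by (simp add: P_def)
      then show ?thesis by blast
    qed
    show "decseq P"
    proof (rule decseq_SucI)
      fix n
      have "\<phi> (s' n) ` X \<subseteq> X" using maps[of "s' n"] s' by auto
      then show "P (Suc n) \<subseteq> P n" by (auto simp: P_def)
    qed
  qed
  then obtain y where y: "\<And>n. y \<in> P n" by blast
  then have "y \<in> attractor X A \<phi>"
    using s' unfolding attractor_def P_def by blast
  moreover have "x = \<phi> (s 0) y" using y[of 0] by (simp add: P_def)
  ultimately show "x \<in> (\<Union>i\<in>A. \<phi> i ` attractor X A \<phi>)" using s0 by blast
qed

section \<open>Covers of the attractor by iterated images\<close>

text \<open>Collections of sets are easier to iterate than sequences. Indices that enumerate nothing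
  get the empty set, of diameter 0.\<close>

lemma length_leI:
  fixes K :: "'a::metric_space set"
  assumes "\<And>\<delta>. \<delta> > 0 \<Longrightarrow> \<exists>C. countable C \<and> K \<subseteq> \<Union>C \<and> (\<forall>S\<in>C. bounded S \<and> diameter S < \<delta>) \<and>
    (\<forall>C'. finite C' \<longrightarrow> C' \<subseteq> C \<longrightarrow> (\<Sum>S\<in>C'. diameter S) \<le> l)"
  shows "length_le K l"
  unfolding length_le_def
proof (intro allI impI)
  fix \<delta> :: real assume \<delta>: "\<delta> > 0"
  obtain C where C: "countable C" "K \<subseteq> \<Union>C" "\<And>S. S \<in> C \<Longrightarrow> bounded S \<and> diameter S < \<delta>"
    and sums: "\<And>C'. finite C' \<Longrightarrow> C' \<subseteq> C \<Longrightarrow> (\<Sum>S\<in>C'. diameter S) \<le> l"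
    using assms[OF \<delta>] by meson
  define I where "I = to_nat_on C ` C"
  define S where "S n = (if n \<in> I then from_nat_into C n else {})" for n
  have inC: "from_nat_into C n \<in> C" if "n \<in> I" for n
    using that C(1) by (auto simp: I_def)
  have inj: "inj_on (from_nat_into C) I"
    using C(1) by (auto simp: I_def inj_on_def)
  have "K \<subseteq> (\<Union>n. S n)"
  proof
    fix x assume "x \<in> K"
    then obtain T where "T \<in> C" "x \<in> T" using C by blast
    then have "x \<in> S (to_nat_on C T)" using C(1) by (auto simp: S_def I_def)
    then show "x \<in> (\<Union>n. S n)" by blast
  qed
  moreover have "bounded (S n) \<and> diameter (S n) < \<delta>" for n
    using C(3) inC \<delta> by (auto simp: S_def)
  moreover have "(\<Sum>n\<in>N. diameter (S n)) \<le> l" if N: "finite N" for N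
  proof -
    have "(\<Sum>n\<in>N. diameter (S n)) = (\<Sum>n\<in>N \<inter> I. diameter (from_nat_into C n))"
      using N by (intro sum.mono_neutral_cong_right) (auto simp: S_def)
    also have "\<dots> = (\<Sum>T\<in>from_nat_into C ` (N \<inter> I). diameter T)"
      using inj by (subst sum.reindex) (auto intro: inj_on_subset)
    also have "\<dots> \<le> l" using N inC by (intro sums) auto
    finally show ?thesis .
  qed
  ultimately show "\<exists>S::nat \<Rightarrow> 'a set. K \<subseteq> (\<Union>n. S n) \<and> (\<forall>n. bounded (S n) \<and> diameter (S n) < \<delta>) \<and>
      (\<forall>N. finite N \<longrightarrow> (\<Sum>n\<in>N. diameter (S n)) \<le> l)"
    by blast
qed

text \<open>Start from the cover \<open>{K}\<close> and repeatedly replace each member by its images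
  under all maps. The sum of the diameters is multiplied by at most the sum of the Lipschitz
  constants, hence never grows, while the mesh tends to 0.\<close>

lemma attractor_length_le_diameter:
  assumes X: "compact X" and ifs: "iterated_function_system X A \<phi>"
    and dim: "similarity_dim X A \<phi> = 1"
  shows "length_le (attractor X A \<phi>) (diameter (attractor X A \<phi>))"
proof -
  define K where "K = attractor X A \<phi>"
  define L where "L i = lip_const X (\<phi> i)" for i
  define D where "D = diameter K"
  have A: "countable A" "A \<noteq> {}" and L: "\<And>i. i \<in> A \<Longrightarrow> L i \<in> {0<..<1}"
    and contr: "\<And>i. i \<in> A \<Longrightarrow> contraction_on X (\<phi> i)"
    using ifs by (auto simp: iterated_function_system_def L_def)
  have maps: "\<And>i. i \<in> A \<Longrightarrow> \<phi> i \<in> X \<rightarrow> X" using contr by (simp add: contraction_on_def)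
  have lip: "\<And>i. i \<in> A \<Longrightarrow> (L i)-lipschitz_on X (\<phi> i)"
    using contr lipschitz_on_lip_const unfolding L_def by blast
  have cover_K: "K \<subseteq> (\<Union>i\<in>A. \<phi> i ` K)"
    unfolding K_def
    by (rule attractor_subset_images[OF X maps lipschitz_on_continuous_on[OF lip]])
  have sumL: "(\<Sum>i\<in>F. L i) \<le> 1" if "finite F" "F \<subseteq> A" for F
    unfolding L_def by (rule sum_lip_const_le_1[OF L[unfolded L_def] dim that])
  have KX: "K \<subseteq> X"
  proof
    fix x assume "x \<in> K"
    then obtain s where s: "s \<in> UNIV \<rightarrow> A" and "x \<in> (\<Inter>n\<in>{1..}. word_map \<phi> s n ` X)"
      unfolding K_def attractor_def by blast
    from INT_D[OF this(2), of "Suc 0"] have "x \<in> word_map \<phi> s (Suc 0) ` X" by simp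
    then obtain z where "z \<in> X" "x = \<phi> (s 0) z" by auto
    moreover have "s 0 \<in> A" using s by auto
    ultimately show "x \<in> X" using maps by blast
  qed
  have bdd: "bounded S" if "S \<subseteq> X" for S
    by (rule bounded_subset[OF compact_imp_bounded[OF X] that])
  have D0: "0 \<le> D" unfolding D_def by (intro diameter_ge_0 bdd KX)
  \<comment> \<open>A uniform ratio below 1 exists even for infinite \<open>A\<close>: any two
    constants sum to at most 1, so all but that of \<open>j\<close> are at most
    \<open>1 - L j\<close>.\<close>
  obtain q where q: "0 < q" "q < 1" "\<And>i. i \<in> A \<Longrightarrow> L i \<le> q"
  proof -
    obtain j where j: "j \<in> A" using A by blast
    have "L i \<le> max (L j) (1 - L j)" if "i \<in> A" for i
      using sumL[of "{i, j}"] that j by (cases "i = j") auto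
    then show thesis using L[OF j] by (intro that[of "max (L j) (1 - L j)"]) auto
  qed
  have cover: "\<exists>C. countable C \<and> K \<subseteq> \<Union>C \<and> (\<forall>S\<in>C. S \<subseteq> X \<and> diameter S \<le> q ^ n * D) \<and>
      (\<forall>C'. finite C' \<longrightarrow> C' \<subseteq> C \<longrightarrow> (\<Sum>S\<in>C'. diameter S) \<le> D)" for n
  proof (induction n)
    case 0
    have "(\<Sum>S\<in>C'. diameter S) \<le> D" if "C' \<subseteq> {K}" for C'
      using that D0 by (auto simp: subset_singleton_iff D_def)
    then show ?case using KX by (intro exI[of _ "{K}"]) (auto simp: D_def)
  next
    case (Suc n)
    then obtain C where C: "countable C" "K \<subseteq> \<Union>C"
      "\<And>S. S \<in> C \<Longrightarrow> S \<subseteq> X" "\<And>S. S \<in> C \<Longrightarrow> diameter S \<le> q ^ n * D"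
      and sums: "\<And>C'. finite C' \<Longrightarrow> C' \<subseteq> C \<Longrightarrow> (\<Sum>S\<in>C'. diameter S) \<le> D"
      by meson
    define g where "g = (\<lambda>(i, S). \<phi> i ` S)"
    have diam: "diameter (\<phi> i ` S) \<le> L i * diameter S" if "i \<in> A" "S \<in> C" for i S
      using that C(3) lip bdd by (meson diameter_lipschitz_image_le lipschitz_on_subset)
    have diam_ge: "0 \<le> diameter S" if "S \<in> C" for S
      using that C(3) by (simp add: diameter_ge_0 bdd)
    have "countable (g ` (A \<times> C))" using A C by blast
    moreover have "K \<subseteq> \<Union>(g ` (A \<times> C))"
    proof
      fix x assume "x \<in> K"
      then obtain i y where "i \<in> A" "y \<in> K" "x = \<phi> i y" using cover_K by blast
      moreover then obtain S where "S \<in> C" "y \<in> S" using C(2) by blast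
      ultimately have "x \<in> g (i, S)" "(i, S) \<in> A \<times> C" by (auto simp: g_def)
      then show "x \<in> \<Union>(g ` (A \<times> C))" by blast
    qed
    moreover have "S \<subseteq> X \<and> diameter S \<le> q ^ Suc n * D" if S: "S \<in> g ` (A \<times> C)" for S
    proof -
      obtain i T where iT: "i \<in> A" "T \<in> C" "S = \<phi> i ` T" using S by (auto simp: g_def)
      have "diameter S \<le> L i * diameter T" using diam iT by simp
      also have "\<dots> \<le> q * (q ^ n * D)"
        using q(1) q(3)[OF iT(1)] C(4)[OF iT(2)] diam_ge[OF iT(2)] by (intro mult_mono) simp_all
      finally have "diameter S \<le> q ^ Suc n * D" by (simp add: mult.assoc)
      moreover have "S \<subseteq> X" using iT(3) maps[OF iT(1)] C(3)[OF iT(2)] by blast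
      ultimately show ?thesis by simp
    qed
    moreover have "(\<Sum>S\<in>C'. diameter S) \<le> D" if C': "finite C'" "C' \<subseteq> g ` (A \<times> C)" for C'
    proof -
      \<comment> \<open>Different pairs may give the same image, so one pair is chosen for each
        member of \<open>C'\<close>.\<close>
      obtain G where G: "G \<subseteq> A \<times> C" "finite G" "inj_on g G" "C' = g ` G"
        using C' by (metis (no_types) finite_imageD subset_image_inj)
      have "(\<Sum>S\<in>C'. diameter S) = (\<Sum>(i, S)\<in>G. diameter (\<phi> i ` S))"
        unfolding G(4) sum.reindex[OF G(3)] by (simp add: g_def case_prod_beta o_def)
      also have "\<dots> \<le> (\<Sum>(i, S)\<in>G. L i * diameter S)"
        using G diam by (intro sum_mono) auto
      \<comment> \<open>Enlarging \<open>G\<close> to a rectangle adds only nonnegative terms and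
        lets the sum factor.\<close>
      also have "\<dots> \<le> (\<Sum>(i, S)\<in>fst ` G \<times> snd ` G. L i * diameter S)"
      proof (rule sum_mono2)
        show "finite (fst ` G \<times> snd ` G)" using G(2) by simp
        show "G \<subseteq> fst ` G \<times> snd ` G" by (rule subset_fst_snd)
        fix z assume "z \<in> fst ` G \<times> snd ` G - G"
        then obtain i S where "z = (i, S)" "i \<in> A" "S \<in> C" using G(1) by fastforce
        then show "0 \<le> (case z of (i, S) \<Rightarrow> L i * diameter S)"
          using L[of i] diam_ge by simp
      qed
      also have "\<dots> = (\<Sum>i\<in>fst ` G. L i) * (\<Sum>S\<in>snd ` G. diameter S)"
        by (simp add: sum_product sum.cartesian_product)
      also have "\<dots> \<le> 1 * D"
        using G D0 diam_ge by (intro mult_mono sumL sums sum_nonneg) auto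
      finally show ?thesis by simp
    qed
    ultimately show ?case
      by (intro exI[of _ "g ` (A \<times> C)"] conjI allI impI ballI; blast)
  qed
  have "length_le K D"
  proof (rule length_leI)
    fix \<delta> :: real assume \<delta>: "\<delta> > 0"
    have "(\<lambda>n. q ^ n * D) \<longlonglongrightarrow> 0"
      using q by (intro tendsto_mult_left_zero LIMSEQ_power_zero) auto
    then have "\<forall>\<^sub>F n in sequentially. q ^ n * D < \<delta>"
      using \<delta> by (rule order_tendstoD)
    then obtain n where n: "q ^ n * D < \<delta>" by (auto simp: eventually_sequentially)
    then show "\<exists>C. countable C \<and> K \<subseteq> \<Union>C \<and> (\<forall>S\<in>C. bounded S \<and> diameter S < \<delta>) \<and>
      (\<forall>C'. finite C' \<longrightarrow> C' \<subseteq> C \<longrightarrow> (\<Sum>S\<in>C'. diameter S) \<le> D)"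
      using cover[of n] bdd by (meson le_less_trans)
  qed
  then show ?thesis by (simp add: K_def D_def)
qed

theorem proposition2p1:
  fixes X :: "'a::metric_space set" and A :: "'i set" and \<phi> :: "'i \<Rightarrow> 'a \<Rightarrow> 'a"
  assumes "compact X"
    and "iterated_function_system X A \<phi>"
    and "continuum (attractor X A \<phi>)"
    and "similarity_dim X A \<phi> = 1"
  shows "\<exists>l\<ge>0. isometric_sets (attractor X A \<phi>) {0..l::real}"
proof (intro exI conjI)
  show "isometric_sets (attractor X A \<phi>) {0..diameter (attractor X A \<phi>)}"
    using assms by (intro isometric_interval_of_length_le_diameter attractor_length_le_diameter)
  show "0 \<le> diameter (attractor X A \<phi>)"
    using assms(3) by (simp add: continuum_def compact_imp_bounded diameter_ge_0)
qed

end
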